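(* Let $p>1$ and consider, for $A\in\mathbb R^{m\times N}$, $y\in\mathbb R^m$, $\eta>0$, the problem $\min_{x\in\mathbb R^N}\|Ax-y\|_2$ subject to $\|x\|_p\le\eta$. (i) If $A$ has full row rank and $0<\eta<\min_{Ax=y}\|x\|_p$, then this problem has a unique optimal solution $x^*$, and there is a unique Lagrange multiplier $\mu$ satisfying the KKT conditions $A^T(Ax^*-y)+\mu\nabla f(x^* )=0$, $0\le\mu\perp f(x^* )-\eta^p\le0$ (with $f(x)=\|x\|_p^p$); moreover $\mu>0$ and $\|x^*\|_p=\eta$. (ii) If every $m\times m$ submatrix of $A$ is invertible (with $N\ge m$), $y\ne0$, and $0<\eta<\min_{Ax=y}\|x\|_p$, then the unique optimal solution satisfies $|\mathrm{supp}(x^* )|\ge N-m+1$.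
   Context: $\|x\|_p:=(\sum_i|x_i|^p)^{1/p}$; $\mathrm{supp}(x)=\{i:x_i\ne0\}$. $a\perp b$ for scalars means $ab=0$. *)

theory Defs
  imports "HOL-Analysis.Analysis"
begin

text \<open>f(x) = sum of |x_i|^p, i.e. the p-th power of the p-norm.\<close>
definition lp_pow :: "real \<Rightarrow> real^'n \<Rightarrow> real" where
  "lp_pow p x = (\<Sum>i\<in>UNIV. \<bar>x $ i\<bar> powr p)"

text \<open>The p-norm.\<close>
definition lp_norm :: "real \<Rightarrow> real^'n \<Rightarrow> real" where
  "lp_norm p x = (lp_pow p x) powr (1 / p)"

text \<open>x is an optimal solution of min ||Ax - y||_2 s.t. ||x||_p \<le> eta.\<close>
definition is_opt :: "real \<Rightarrow> real^'n^'m \<Rightarrow> real^'m \<Rightarrow> real \<Rightarrow> real^'n \<Rightarrow> bool" where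
  "is_opt p A y \<eta> x \<longleftrightarrow> lp_norm p x \<le> \<eta> \<and>
     (\<forall>z. lp_norm p z \<le> \<eta> \<longrightarrow> norm (A *v x - y) \<le> norm (A *v z - y))"

text \<open>KKT conditions with multiplier mu at x:
  A^T(Ax-y) + mu grad f(x) = 0, 0 \<le> mu \<perp> f(x) - eta^p \<le> 0.\<close>
definition is_kkt_mult :: "real \<Rightarrow> real^'n^'m \<Rightarrow> real^'m \<Rightarrow> real \<Rightarrow> real^'n \<Rightarrow> real \<Rightarrow> bool" where
  "is_kkt_mult p A y \<eta> x \<mu> \<longleftrightarrow>
     (\<exists>g. (GDERIV (lp_pow p) x :> g) \<and> transpose A *v (A *v x - y) + \<mu> *\<^sub>R g = 0) \<and>
     0 \<le> \<mu> \<and> lp_pow p x - \<eta> powr p \<le> 0 \<and> \<mu> * (lp_pow p x - \<eta> powr p) = 0"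

text \<open>Every m x m submatrix (choice of m distinct columns) is invertible.\<close>
definition all_square_submatrices_invertible :: "real^'n^'m \<Rightarrow> bool" where
  "all_square_submatrices_invertible A \<longleftrightarrow>
     (\<forall>c :: 'm \<Rightarrow> 'n. inj c \<longrightarrow> invertible ((\<chi> i k. A $ i $ c k) :: real^'m^'m))"

end

theory Submission
  imports Defs
begin

text \<open>For \<open>p > 1\<close> the function \<open>f x = \<Sum>i. \<bar>x i\<bar> powr p\<close> is differentiable and strictly convex,
  and the ball \<open>f x \<le> \<eta> powr p\<close> is compact, so a minimizer of the residual exists. As every
  solution of \<open>A x = y\<close> lies outside the ball, a minimizer inside the ball could be pushed
  towards such a solution, shrinking the residual; so all minimizers lie on the sphere, and by
  strict convexity the midpoint of two distinct ones would be an interior minimizer.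
  On the sphere \<open>\<nabla>f x \<noteq> 0\<close>, so the KKT theorem for a single constraint yields
  \<open>A\<^sup>T (A x - y) + \<mu> \<nabla>f x = 0\<close> with a unique \<open>\<mu> \<ge> 0\<close>, and \<open>\<mu> = 0\<close> would contradict
  \<open>A x \<noteq> y\<close> when \<open>A\<^sup>T\<close> is injective. Since \<open>\<nabla>f\<close> vanishes exactly where \<open>x\<close> does,
  \<open>A\<^sup>T (A x - y)\<close> vanishes on the zero set of \<open>x\<close>; were that set of size \<open>m\<close>, the
  corresponding invertible \<open>m \<times> m\<close> submatrix would force \<open>A x = y\<close>.\<close>

definition abs_powr_deriv :: "real \<Rightarrow> real \<Rightarrow> real" where
  "abs_powr_deriv p t = p * sgn t * \<bar>t\<bar> powr (p - 1)"

definition lp_grad :: "real \<Rightarrow> real^'n \<Rightarrow> real^'n" where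
  "lp_grad p x = (\<chi> i. abs_powr_deriv p (x $ i))"

lemma has_real_derivative_abs_powr:
  assumes p: "p > 1"
  shows "((\<lambda>s. \<bar>s\<bar> powr p) has_real_derivative abs_powr_deriv p t) (at t)"
proof (cases "t > 0")
  case True
  have ev: "eventually (\<lambda>s. \<bar>s\<bar> powr p = s powr p) (nhds t)"
    using eventually_nhds_in_open[of "{0<..}" t] True
    by (auto elim!: eventually_mono)
  show ?thesis
    using True has_real_derivative_powr[OF True]
    by (subst DERIV_cong_ev[OF refl ev refl]) (simp add: abs_powr_deriv_def)
next
  case False
  show ?thesis
  proof (cases "t < 0")
    case True
    have ev: "eventually (\<lambda>s. \<bar>s\<bar> powr p = (-s) powr p) (nhds t)"
      using eventually_nhds_in_open[of "{..<0}" t] True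
      by (auto elim!: eventually_mono)
    have "((\<lambda>s. (-s) powr p) has_real_derivative p * (-t) powr (p - 1) * (-1)) (at t)"
      using True by (auto intro!: derivative_eq_intros)
    then show ?thesis
      using True by (subst DERIV_cong_ev[OF refl ev refl]) (simp add: abs_powr_deriv_def)
  next
    case False
    with \<open>\<not> t > 0\<close> have t0: "t = 0" by simp
    have quotient: "\<bar>h\<bar> powr (p - 1) = \<bar>(\<bar>0 + h\<bar> powr p - \<bar>0::real\<bar> powr p) / h\<bar>"
      if "h \<noteq> 0" for h
      using that powr_diff[of "\<bar>h\<bar>" p 1] by (simp add: abs_divide)
    have "((\<lambda>h. \<bar>h\<bar> powr (p - 1)) \<longlongrightarrow> 0) (at (0::real))"
      using p by (intro tendsto_zero_powrI) (auto intro!: tendsto_eq_intros)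
    then have "((\<lambda>h. \<bar>(\<bar>0 + h\<bar> powr p - \<bar>0::real\<bar> powr p) / h\<bar>) \<longlongrightarrow> 0) (at (0::real))"
      by (rule Lim_transform_eventually) (simp add: eventually_at_filter quotient)
    then have "((\<lambda>h. (\<bar>0 + h\<bar> powr p - \<bar>0::real\<bar> powr p) / h) \<longlongrightarrow> 0) (at (0::real))"
      by (rule tendsto_rabs_zero_cancel)
    then show ?thesis using t0 by (simp add: DERIV_def abs_powr_deriv_def)
  qed
qed

lemma abs_powr_deriv_strict_mono:
  assumes p: "p > 1" and st: "s < t"
  shows "abs_powr_deriv p s < abs_powr_deriv p t"
proof -
  have p1: "p - 1 > 0" using p by simp
  consider "0 \<le> s" | "t \<le> 0" | "s < 0" "0 < t" by linarith
  then show ?thesis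
  proof cases
    case 1
    then have "\<bar>s\<bar> powr (p - 1) < \<bar>t\<bar> powr (p - 1)"
      using st p1 by (intro powr_less_mono2) auto
    then show ?thesis using 1 st p
      by (cases "s = 0") (auto simp: abs_powr_deriv_def sgn_if)
  next
    case 2
    then have "\<bar>t\<bar> powr (p - 1) < \<bar>s\<bar> powr (p - 1)"
      using st p1 by (intro powr_less_mono2) auto
    then show ?thesis using 2 st p
      by (cases "t = 0") (auto simp: abs_powr_deriv_def sgn_if)
  next
    case 3
    then have "abs_powr_deriv p s < 0" "abs_powr_deriv p t > 0"
      using p by (auto simp: abs_powr_deriv_def sgn_if)
    then show ?thesis by linarith
  qed
qed

lemma abs_powr_deriv_eq_0_iff:
  assumes "p > 1"
  shows "abs_powr_deriv p t = 0 \<longleftrightarrow> t = 0"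
  using assms by (auto simp: abs_powr_deriv_def sgn_if)

text \<open>By the mean value theorem and the strict monotonicity of the derivative, the increment
  over the right half of \<open>[u, v]\<close> exceeds the one over the left half.\<close>
lemma abs_powr_midpoint_less:
  fixes u v :: real
  assumes p: "p > 1" and "u \<noteq> v"
  shows "\<bar>(u + v) / 2\<bar> powr p < (\<bar>u\<bar> powr p + \<bar>v\<bar> powr p) / 2"
proof -
  have ordered: "\<bar>(u + v) / 2\<bar> powr p < (\<bar>u\<bar> powr p + \<bar>v\<bar> powr p) / 2"
    if uv: "u < v" for u v :: real
  proof -
    define m where "m = (u + v) / 2"
    define f where "f = (\<lambda>s::real. \<bar>s\<bar> powr p)"
    have D: "\<And>s. DERIV f s :> abs_powr_deriv p s"
      unfolding f_def using has_real_derivative_abs_powr[OF p] .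
    have "u < m" "m < v" using uv by (auto simp: m_def)
    obtain z1 where z1: "z1 < m" "f m - f u = (m - u) * abs_powr_deriv p z1"
      using MVT2[OF \<open>u < m\<close> D] by blast
    obtain z2 where z2: "m < z2" "f v - f m = (v - m) * abs_powr_deriv p z2"
      using MVT2[OF \<open>m < v\<close> D] by blast
    have "abs_powr_deriv p z1 < abs_powr_deriv p z2"
      using z1 z2 by (intro abs_powr_deriv_strict_mono[OF p]) auto
    moreover have "m - u = v - m" "m - u > 0" using uv by (simp_all add: m_def field_simps)
    ultimately have "f m - f u < f v - f m"
      using z1(2) z2(2) by (metis mult_strict_left_mono)
    then show ?thesis by (simp add: f_def m_def)
  qed
  show ?thesis
    using \<open>u \<noteq> v\<close> ordered[of u v] ordered[of v u]
    by (cases "u < v") (auto simp: add.commute)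
qed

lemma lp_pow_nonneg: "lp_pow p x \<ge> 0"
  unfolding lp_pow_def by (intro sum_nonneg) auto

lemma lp_pow_zero [simp]: "p > 0 \<Longrightarrow> lp_pow p 0 = 0"
  by (simp add: lp_pow_def)

lemma lp_pow_midpoint_less:
  assumes p: "p > 1" and ab: "a \<noteq> b"
  shows "lp_pow p ((1/2) *\<^sub>R (a + b)) < (lp_pow p a + lp_pow p b) / 2"
proof -
  obtain j where j: "a $ j \<noteq> b $ j" using ab by (auto simp: vec_eq_iff)
  have le: "\<bar>(a $ i + b $ i) / 2\<bar> powr p \<le> (\<bar>a $ i\<bar> powr p + \<bar>b $ i\<bar> powr p) / 2" for i
    using abs_powr_midpoint_less[OF p, of "a $ i" "b $ i"] by (cases "a $ i = b $ i") simp_all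
  have "lp_pow p ((1/2) *\<^sub>R (a + b)) = (\<Sum>i\<in>UNIV. \<bar>(a $ i + b $ i) / 2\<bar> powr p)"
    unfolding lp_pow_def by (simp add: field_simps)
  also have "\<dots> < (\<Sum>i\<in>UNIV. (\<bar>a $ i\<bar> powr p + \<bar>b $ i\<bar> powr p) / 2)"
    using abs_powr_midpoint_less[OF p j] le by (intro sum_strict_mono_ex1) auto
  also have "\<dots> = (lp_pow p a + lp_pow p b) / 2"
    unfolding lp_pow_def by (simp only: sum_divide_distrib[symmetric] sum.distrib)
  finally show ?thesis .
qed

lemma lp_norm_le_iff:
  assumes p: "p > 0" and eta: "\<eta> > 0"
  shows "lp_norm p z \<le> \<eta> \<longleftrightarrow> lp_pow p z \<le> \<eta> powr p"
proof
  assume "lp_pow p z \<le> \<eta> powr p"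
  then have "lp_pow p z powr (1/p) \<le> (\<eta> powr p) powr (1/p)"
    using p lp_pow_nonneg by (intro powr_mono2) auto
  then show "lp_norm p z \<le> \<eta>"
    using p eta by (simp add: lp_norm_def powr_powr)
next
  assume "lp_norm p z \<le> \<eta>"
  then show "lp_pow p z \<le> \<eta> powr p"
    using p eta powr_less_mono2[of "1/p" "\<eta> powr p" "lp_pow p z"]
    by (force simp: lp_norm_def powr_powr)
qed

lemma lp_norm_eqI:
  assumes "p > 0" and "\<eta> > 0" and "lp_pow p z = \<eta> powr p"
  shows "lp_norm p z = \<eta>"
  using assms by (simp add: lp_norm_def powr_powr)

lemma has_gderiv_lp_pow:
  fixes x :: "real^'n"
  assumes p: "p > 1"
  shows "GDERIV (lp_pow p) x :> lp_grad p x"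
proof -
  have coord: "((\<lambda>x. \<bar>x $ i\<bar> powr p) has_derivative (\<lambda>h. abs_powr_deriv p (x $ i) * h $ i)) (at x)"
    for i
    using has_derivative_compose[OF bounded_linear.has_derivative[OF bounded_linear_vec_nth has_derivative_ident]
        has_real_derivative_abs_powr[OF p, unfolded has_field_derivative_def]] .
  have "(lp_pow p has_derivative (\<lambda>h. \<Sum>i\<in>UNIV. abs_powr_deriv p (x $ i) * h $ i)) (at x)"
    unfolding lp_pow_def[abs_def] by (intro has_derivative_sum coord)
  then show ?thesis
    by (simp add: gderiv_def inner_vec_def lp_grad_def mult.commute)
qed

lemma continuous_on_lp_pow:
  assumes "p > 1"
  shows "continuous_on S (lp_pow p)"
  using has_gderiv_lp_pow[OF assms] unfolding gderiv_def
  by (meson continuous_at_imp_continuous_on has_derivative_continuous)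

lemma compact_lp_pow_sublevel:
  assumes p: "p > 1" and eta: "\<eta> > 0"
  shows "compact {z::real^'n. lp_pow p z \<le> \<eta> powr p}"
proof -
  have "closed {z::real^'n. lp_pow p z \<le> \<eta> powr p}"
    by (intro closed_Collect_le continuous_on_lp_pow[OF p] continuous_on_const)
  moreover have "norm z \<le> real CARD('n) * \<eta>" if z: "lp_pow p z \<le> \<eta> powr p" for z :: "real^'n"
  proof -
    have "\<bar>z $ i\<bar> \<le> \<eta>" for i
    proof (rule ccontr)
      assume "\<not> ?thesis"
      then have "\<eta> powr p < \<bar>z $ i\<bar> powr p" using p eta by (intro powr_less_mono2) auto
      also have "\<dots> \<le> lp_pow p z"
        unfolding lp_pow_def by (rule member_le_sum) auto
      finally show False using z by simp
    qed
    then have "(\<Sum>i\<in>UNIV. \<bar>z $ i\<bar>) \<le> real CARD('n) * \<eta>"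
      by (intro sum_bounded_above) auto
    then show ?thesis using norm_le_l1_cart[of z] by simp
  qed
  then have "bounded {z::real^'n. lp_pow p z \<le> \<eta> powr p}"
    unfolding bounded_iff by blast
  ultimately show ?thesis by (simp add: compact_eq_bounded_closed)
qed

lemma lp_grad_eq_0_iff:
  assumes "p > 1"
  shows "lp_grad p x = 0 \<longleftrightarrow> x = 0"
  using abs_powr_deriv_eq_0_iff[OF assms] by (simp add: lp_grad_def vec_eq_iff)

lemma gderiv_unique:
  fixes f :: "'a::real_inner \<Rightarrow> real"
  assumes "GDERIV f x :> g1" "GDERIV f x :> g2"
  shows "g1 = g2"
proof -
  have "(\<lambda>h. inner h g1) = (\<lambda>h. inner h g2)"
    using assms unfolding gderiv_def by (rule has_derivative_unique)
  then have "inner (g1 - g2) g1 = inner (g1 - g2) g2" by metis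
  then have "inner (g1 - g2) (g1 - g2) = 0" by (simp add: inner_diff_right)
  then show ?thesis by simp
qed

lemma has_real_derivative_along_line:
  assumes "GDERIV f x :> g"
  shows "((\<lambda>t. f (x + t *\<^sub>R d)) has_real_derivative inner d g) (at 0)"
proof -
  have "((\<lambda>t. x + t *\<^sub>R d) has_derivative (\<lambda>t. t *\<^sub>R d)) (at 0)"
    by (auto intro!: derivative_eq_intros)
  moreover have "(f has_derivative (\<lambda>h. inner h g)) (at (x + 0 *\<^sub>R d))"
    using assms by (simp add: gderiv_def)
  ultimately have "((\<lambda>t. f (x + t *\<^sub>R d)) has_derivative (\<lambda>t. inner (t *\<^sub>R d) g)) (at 0)"
    by (rule has_derivative_compose)
  then show ?thesis
    unfolding has_field_derivative_def by (rule has_derivative_eq_rhs) (auto simp: fun_eq_iff)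
qed

text \<open>The component \<open>w\<close> of \<open>r\<close> orthogonal to \<open>g\<close> must vanish, as testing the direction
  \<open>-w - \<epsilon> g\<close> for small \<open>\<epsilon> > 0\<close> shows.\<close>
lemma nonneg_multiplier_of_descent_directions:
  fixes r g :: "'a::real_inner"
  assumes g: "g \<noteq> 0" and descent: "\<And>d. inner g d < 0 \<Longrightarrow> inner r d \<ge> 0"
  shows "\<exists>\<mu>\<ge>0. r + \<mu> *\<^sub>R g = 0"
proof -
  define \<mu> where "\<mu> = - inner r g / inner g g"
  define w where "w = r + \<mu> *\<^sub>R g"
  have gg: "inner g g > 0" using g by simp
  have "inner r g \<le> 0" using descent[of "-g"] gg by simp
  then have \<mu>: "\<mu> \<ge> 0" using gg by (simp add: \<mu>_def divide_nonpos_pos)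
  have "inner g w = inner g r + \<mu> * inner g g" by (simp add: w_def inner_add_right)
  then have wg: "inner g w = 0" using gg by (simp add: \<mu>_def inner_commute)
  have "inner w w = inner r w + \<mu> * inner g w"
    by (subst (1) w_def) (simp add: inner_add_left)
  with wg have rw: "inner r w = inner w w" by simp
  have "w = 0"
  proof (rule ccontr)
    assume "w \<noteq> 0"
    then have ww: "inner w w > 0" by simp
    define c where "c = \<bar>inner r g\<bar>"
    define \<epsilon> where "\<epsilon> = inner w w / (c + 1)"
    have \<epsilon>: "\<epsilon> > 0" using ww by (simp add: \<epsilon>_def c_def)
    have "\<epsilon> * (c + 1) = inner w w" by (simp add: \<epsilon>_def c_def)
    have "inner g (-w - \<epsilon> *\<^sub>R g) < 0" using wg \<epsilon> gg by (simp add: inner_diff_right)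
    then have "0 \<le> inner r (-w - \<epsilon> *\<^sub>R g)" by (rule descent)
    also have "\<dots> = - inner w w - \<epsilon> * inner r g"
      using rw by (simp add: inner_diff_right)
    also have "\<dots> \<le> - inner w w + \<epsilon> * c"
      using mult_left_mono[OF abs_ge_minus_self[of "inner r g"], of \<epsilon>] \<epsilon> by (simp add: c_def)
    also have "\<dots> < 0"
      using \<epsilon> \<open>\<epsilon> * (c + 1) = inner w w\<close> by (simp add: distrib_left)
    finally show False by simp
  qed
  then show ?thesis using \<mu> unfolding w_def by blast
qed

lemma kkt_single_constraint:
  fixes F G :: "'a::real_inner \<Rightarrow> real"
  assumes F: "GDERIV F x :> r" and G: "GDERIV G x :> g" and "g \<noteq> 0"
    and min: "\<And>z. G z \<le> G x \<Longrightarrow> F x \<le> F z"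
  shows "\<exists>\<mu>\<ge>0. r + \<mu> *\<^sub>R g = 0"
proof (rule nonneg_multiplier_of_descent_directions[OF \<open>g \<noteq> 0\<close>])
  fix d assume gd: "inner g d < 0"
  show "inner r d \<ge> 0"
  proof (rule ccontr)
    assume "\<not> inner r d \<ge> 0"
    then have "inner d r < 0" by (simp add: inner_commute)
    from DERIV_neg_dec_right[OF has_real_derivative_along_line[OF F] this]
    obtain \<delta>F where "\<delta>F > 0" and F_dec: "\<forall>h>0. h < \<delta>F \<longrightarrow> F (x + h *\<^sub>R d) < F x"
      by auto
    from gd have "inner d g < 0" by (simp add: inner_commute)
    from DERIV_neg_dec_right[OF has_real_derivative_along_line[OF G] this]
    obtain \<delta>G where "\<delta>G > 0" and G_dec: "\<forall>h>0. h < \<delta>G \<longrightarrow> G (x + h *\<^sub>R d) < G x"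
      by auto
    define h where "h = min \<delta>F \<delta>G / 2"
    have "h > 0" "h < \<delta>F" "h < \<delta>G"
      using \<open>\<delta>F > 0\<close> \<open>\<delta>G > 0\<close> by (auto simp: h_def)
    then have "G (x + h *\<^sub>R d) \<le> G x" "F (x + h *\<^sub>R d) < F x"
      using F_dec G_dec by auto
    then show False
      using min[of "x + h *\<^sub>R d"] by simp
  qed
qed

lemma has_gderiv_half_residual_sq:
  fixes A :: "real^'n^'m"
  shows "GDERIV (\<lambda>z. (norm (A *v z - y))\<^sup>2 / 2) x :> transpose A *v (A *v x - y)"
proof -
  have "((\<lambda>z. inner (A *v z - y) (A *v z - y) / 2) has_derivative
      (\<lambda>h. (inner (A *v h) (A *v x - y) + inner (A *v x - y) (A *v h)) / 2)) (at x)"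
    by (auto intro!: derivative_eq_intros
        bounded_linear.has_derivative[OF matrix_vector_mul_bounded_linear])
  moreover have "inner (A *v h) (A *v x - y) = inner h (transpose A *v (A *v x - y))" for h
    by (metis dot_lmul_matrix inner_commute vector_transpose_matrix)
  ultimately show ?thesis
    unfolding gderiv_def power2_norm_eq_inner by (simp add: inner_commute)
qed

lemma lp_pow_gt_of_lt_Inf:
  fixes A :: "real^'n^'m"
  assumes p: "p > 1" and eta: "\<eta> > 0"
    and eta_lt: "\<eta> < Inf {lp_norm p x | x. A *v x = y}" and z: "A *v z = y"
  shows "\<eta> powr p < lp_pow p z"
proof -
  have "bdd_below {lp_norm p x | x. A *v x = y}"
    by (rule bdd_belowI[of _ 0]) (auto simp: lp_norm_def)
  then have "Inf {lp_norm p x | x. A *v x = y} \<le> lp_norm p z"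
    using z by (intro cInf_lower) auto
  then show ?thesis
    using eta_lt lp_norm_le_iff[of p \<eta> z] p eta by auto
qed

lemma submatrix_eq_matrix_mult_selection:
  fixes A :: "'a::semiring_1^'n^'m" and c :: "'k::finite \<Rightarrow> 'n"
  shows "(\<chi> i k. A $ i $ c k) = A ** (\<chi> j k. if j = c k then 1 else 0)"
  by (simp add: vec_eq_iff matrix_matrix_mult_def if_distrib cong: if_cong)

lemma surj_of_all_square_submatrices_invertible:
  fixes A :: "real^'n^'m"
  assumes A: "all_square_submatrices_invertible A" and card: "CARD('m) \<le> CARD('n)"
  shows "surj ((*v) A)"
proof -
  obtain c :: "'m \<Rightarrow> 'n" where "inj c"
    using card card_le_inj[of "UNIV::'m set" "UNIV::'n set"] by auto
  define S :: "real^'m^'n" where "S = (\<chi> j k. if j = c k then 1 else 0)"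
  have "invertible ((\<chi> i k. A $ i $ c k) :: real^'m^'m)"
    using A \<open>inj c\<close> unfolding all_square_submatrices_invertible_def by blast
  then have "invertible (A ** S)"
    by (metis S_def submatrix_eq_matrix_mult_selection)
  then have "surj ((*v) (A ** S))"
    by (simp add: invertible_right_inverse matrix_right_invertible_surjective)
  show ?thesis
    unfolding surj_def
  proof
    fix v
    obtain w where "v = (A ** S) *v w" using \<open>surj ((*v) (A ** S))\<close> by blast
    then have "v = A *v (S *v w)" by (simp add: matrix_vector_mul_assoc)
    then show "\<exists>z. v = A *v z" ..
  qed
qed

lemma all_square_submatrices_invertible_transpose_eq_0:
  fixes A :: "real^'n^'m"
  assumes A: "all_square_submatrices_invertible A"
    and zeros: "CARD('m) \<le> card {j. (transpose A *v e) $ j = 0}"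
  shows "e = 0"
proof -
  obtain c :: "'m \<Rightarrow> 'n" where c: "range c \<subseteq> {j. (transpose A *v e) $ j = 0}" "inj c"
    using zeros card_le_inj[of "UNIV::'m set" "{j. (transpose A *v e) $ j = 0}"] by auto
  define B where "B = ((\<chi> i k. A $ i $ c k) :: real^'m^'m)"
  have "invertible (transpose B)"
    using A c(2) transpose_invertible by (auto simp: all_square_submatrices_invertible_def B_def)
  moreover have "transpose B *v e = 0"
    using c(1) by (auto simp: vec_eq_iff B_def vector_matrix_mult_def)
  ultimately show ?thesis
    by (metis invertible_left_inverse matrix_left_invertible_ker)
qed

context
  fixes p \<eta> :: real and A :: "real^'n^'m" and y :: "real^'m"
  assumes p: "p > 1" and eta: "\<eta> > 0"
    and solvable: "\<exists>z. A *v z = y"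
    and solutions_outside: "\<And>z. A *v z = y \<Longrightarrow> \<eta> powr p < lp_pow p z"
begin

lemma feasible_iff: "lp_norm p z \<le> \<eta> \<longleftrightarrow> lp_pow p z \<le> \<eta> powr p"
  using lp_norm_le_iff[of p \<eta> z] p eta by simp

lemma is_opt_exists: "\<exists>x. is_opt p A y \<eta> x"
proof -
  let ?S = "{z::real^'n. lp_pow p z \<le> \<eta> powr p}"
  have "0 \<in> ?S" using p eta by simp
  moreover have "continuous_on ?S (\<lambda>z. norm (A *v z - y))"
    by (intro continuous_intros)
  ultimately obtain x where "x \<in> ?S" "\<forall>z\<in>?S. norm (A *v x - y) \<le> norm (A *v z - y)"
    using continuous_attains_inf[OF compact_lp_pow_sublevel[OF p eta]] by blast
  then show ?thesis
    unfolding is_opt_def feasible_iff by blast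
qed

text \<open>An optimum strictly inside the ball could be moved towards a solution of \<open>A z = y\<close>,
  which scales the residual by a factor \<open>1 - t < 1\<close>; so the residual would vanish.\<close>
lemma is_opt_lp_pow_eq:
  assumes opt: "is_opt p A y \<eta> x"
  shows "lp_pow p x = \<eta> powr p"
proof (rule ccontr)
  assume "lp_pow p x \<noteq> \<eta> powr p"
  then have lt: "lp_pow p x < \<eta> powr p"
    using opt by (simp add: is_opt_def feasible_iff)
  obtain z where z: "A *v z = y" using solvable by blast
  have "isCont (\<lambda>t. lp_pow p (x + t *\<^sub>R (z - x))) 0"
    by (rule DERIV_isCont[OF has_real_derivative_along_line[OF has_gderiv_lp_pow[OF p]]])
  then have "((\<lambda>t. lp_pow p (x + t *\<^sub>R (z - x))) \<longlongrightarrow> lp_pow p x) (at_right 0)"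
    by (auto simp: isCont_def intro: tendsto_mono[OF at_le[OF subset_UNIV]])
  then have "\<forall>\<^sub>F t in at_right 0. lp_pow p (x + t *\<^sub>R (z - x)) < \<eta> powr p"
    using lt by (simp add: order_tendstoD(2))
  moreover have "\<forall>\<^sub>F t in at_right (0::real). 0 < t \<and> t < 1"
    by (simp add: eventually_at_right_field) (meson zero_less_one)
  ultimately obtain t where t: "0 < t" "t < 1" "lp_pow p (x + t *\<^sub>R (z - x)) < \<eta> powr p"
    using eventually_happens'[OF trivial_limit_at_right_real] eventually_conj by blast
  have "norm (A *v x - y) \<le> norm (A *v (x + t *\<^sub>R (z - x)) - y)"
    using opt t(3) unfolding is_opt_def feasible_iff by simp
  also have "A *v (x + t *\<^sub>R (z - x)) - y = (1 - t) *\<^sub>R (A *v x - y)"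
    using z by (simp add: algebra_simps)
  finally have "norm (A *v x - y) \<le> (1 - t) * norm (A *v x - y)"
    using t by simp
  then have "A *v x = y"
    using t by (simp add: algebra_simps mult_le_0_iff)
  then show False using solutions_outside lt by fastforce
qed

lemma is_opt_lp_norm_eq:
  assumes "is_opt p A y \<eta> x"
  shows "lp_norm p x = \<eta>"
  using is_opt_lp_pow_eq[OF assms] p eta by (intro lp_norm_eqI) auto

lemma is_opt_nonzero:
  assumes "is_opt p A y \<eta> x"
  shows "x \<noteq> 0"
  using is_opt_lp_pow_eq[OF assms] p eta by auto

lemma is_opt_residual_nonzero:
  assumes "is_opt p A y \<eta> x"
  shows "A *v x - y \<noteq> 0"
  using solutions_outside is_opt_lp_pow_eq[OF assms] by fastforce

text \<open>The midpoint of two distinct optima is feasible with no larger residual, hence again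
  optimal, but lies strictly inside the ball by strict convexity of \<open>lp_pow p\<close>.\<close>
lemma is_opt_unique:
  assumes o1: "is_opt p A y \<eta> x1" and o2: "is_opt p A y \<eta> x2"
  shows "x1 = x2"
proof (rule ccontr)
  assume "x1 \<noteq> x2"
  define m where "m = (1/2) *\<^sub>R (x1 + x2)"
  have inside: "lp_pow p m < \<eta> powr p"
    using lp_pow_midpoint_less[OF p \<open>x1 \<noteq> x2\<close>] is_opt_lp_pow_eq[OF o1] is_opt_lp_pow_eq[OF o2]
    by (simp add: m_def)
  have same: "norm (A *v x1 - y) = norm (A *v x2 - y)"
    using o1 o2 by (simp add: is_opt_def order_antisym)
  have "A *v m = (1/2) *\<^sub>R (A *v x1 + A *v x2)"
    by (simp add: m_def matrix_vector_mult_scaleR matrix_vector_right_distrib)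
  then have "A *v m - y = (1/2) *\<^sub>R ((A *v x1 - y) + (A *v x2 - y))"
    by (simp add: scaleR_right_distrib scaleR_right_diff_distrib)
  then have "norm (A *v m - y) \<le> norm (A *v x1 - y)"
    using norm_triangle_ineq[of "A *v x1 - y" "A *v x2 - y"] same by simp
  then have "is_opt p A y \<eta> m"
    using o1 inside unfolding is_opt_def feasible_iff by fastforce
  then show False using is_opt_lp_pow_eq inside by simp
qed

lemma is_opt_ex1: "\<exists>!x. is_opt p A y \<eta> x"
  using is_opt_exists is_opt_unique by blast

lemma is_opt_kkt:
  assumes opt: "is_opt p A y \<eta> x"
  shows "\<exists>\<mu>\<ge>0. transpose A *v (A *v x - y) + \<mu> *\<^sub>R lp_grad p x = 0"
proof -
  have "lp_grad p x \<noteq> 0"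
    using is_opt_nonzero[OF opt] by (simp add: lp_grad_eq_0_iff[OF p])
  moreover have "(norm (A *v x - y))\<^sup>2 / 2 \<le> (norm (A *v z - y))\<^sup>2 / 2"
    if "lp_pow p z \<le> lp_pow p x" for z
    using opt that is_opt_lp_pow_eq[OF opt] by (simp add: is_opt_def feasible_iff power_mono)
  ultimately show ?thesis
    using kkt_single_constraint[OF has_gderiv_half_residual_sq has_gderiv_lp_pow[OF p]] by blast
qed

lemma is_kkt_mult_iff:
  "is_kkt_mult p A y \<eta> x \<mu> \<longleftrightarrow>
     0 \<le> \<mu> \<and> lp_pow p x \<le> \<eta> powr p \<and> \<mu> * (lp_pow p x - \<eta> powr p) = 0 \<and>
     transpose A *v (A *v x - y) + \<mu> *\<^sub>R lp_grad p x = 0"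
  using has_gderiv_lp_pow[OF p] gderiv_unique[OF has_gderiv_lp_pow[OF p]]
  unfolding is_kkt_mult_def by (auto simp del: scaleR_eq_0_iff)

lemma is_opt_ex1_kkt_mult:
  assumes opt: "is_opt p A y \<eta> x"
  shows "\<exists>!\<mu>. is_kkt_mult p A y \<eta> x \<mu>"
proof -
  obtain \<mu> where "\<mu> \<ge> 0" and eq: "transpose A *v (A *v x - y) + \<mu> *\<^sub>R lp_grad p x = 0"
    using is_opt_kkt[OF opt] by blast
  then have "is_kkt_mult p A y \<eta> x \<mu>"
    by (simp add: is_kkt_mult_iff is_opt_lp_pow_eq[OF opt])
  moreover have "lp_grad p x \<noteq> 0"
    using is_opt_nonzero[OF opt] by (simp add: lp_grad_eq_0_iff[OF p])
  then have "\<mu>' = \<mu>" if "is_kkt_mult p A y \<eta> x \<mu>'" for \<mu>'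
    using that eq by (simp add: is_kkt_mult_iff) (metis add_left_cancel scaleR_cancel_right)
  ultimately show ?thesis by blast
qed

lemma is_kkt_mult_pos:
  assumes rank: "rank A = CARD('m)" and opt: "is_opt p A y \<eta> x"
    and kkt: "is_kkt_mult p A y \<eta> x \<mu>"
  shows "\<mu> > 0"
proof (rule ccontr)
  assume "\<not> \<mu> > 0"
  then have "\<mu> = 0" using kkt by (simp add: is_kkt_mult_iff)
  then have "transpose A *v (A *v x - y) = 0"
    using kkt by (simp add: is_kkt_mult_iff)
  moreover have "inj ((*v) (transpose A))"
    using rank full_rank_injective[of "transpose A"] by (simp add: rank_transpose)
  ultimately have "A *v x - y = 0"
    by (metis injD matrix_vector_mult_0_right)
  then show False using is_opt_residual_nonzero[OF opt] by simp
qed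

text \<open>Where \<open>x\<close> vanishes so does the gradient of \<open>lp_pow p\<close>, hence by the KKT equation also
  \<open>A\<^sup>T (A x - y)\<close>; with a nonzero residual this can happen in fewer than \<open>m\<close> coordinates.\<close>
lemma is_opt_card_support:
  assumes A: "all_square_submatrices_invertible A" and opt: "is_opt p A y \<eta> x"
  shows "CARD('n) - CARD('m) + 1 \<le> card {i. x $ i \<noteq> 0}"
proof -
  obtain \<mu> where eq: "transpose A *v (A *v x - y) + \<mu> *\<^sub>R lp_grad p x = 0"
    using is_opt_kkt[OF opt] by blast
  have "(transpose A *v (A *v x - y)) $ i = 0" if "x $ i = 0" for i
  proof -
    have "(transpose A *v (A *v x - y) + \<mu> *\<^sub>R lp_grad p x) $ i = 0"
      using eq by simp
    then show ?thesis using that by (simp add: lp_grad_def abs_powr_deriv_def)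
  qed
  then have "{i. x $ i = 0} \<subseteq> {j. (transpose A *v (A *v x - y)) $ j = 0}"
    by blast
  then have "card {i. x $ i = 0} < CARD('m)"
    using all_square_submatrices_invertible_transpose_eq_0[OF A] is_opt_residual_nonzero[OF opt]
    by (meson card_mono finite le_trans not_le)
  moreover have "card {i. x $ i = 0} + card {i. x $ i \<noteq> 0} = CARD('n)"
    by (subst card_Un_disjoint[symmetric]) (auto intro: arg_cong[where f = card])
  moreover have "{i. x $ i \<noteq> 0} \<noteq> {}"
    using is_opt_nonzero[OF opt] by (auto simp: vec_eq_iff)
  then have "card {i. x $ i \<noteq> 0} \<ge> 1"
    by (simp add: Suc_leI card_gt_0_iff)
  ultimately show ?thesis by linarith
qed

end

theorem proposition3p2:
  fixes A :: "real^'n^'m" and y :: "real^'m" and p \<eta> :: real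
  assumes p: "p > 1"
    and eta_pos: "0 < \<eta>"
    and eta_lt: "\<eta> < Inf {lp_norm p x | x. A *v x = y}"
  shows
    "(rank A = CARD('m) \<longrightarrow>
        (\<exists>!x. is_opt p A y \<eta> x) \<and>
        (\<forall>x. is_opt p A y \<eta> x \<longrightarrow>
           (\<exists>!\<mu>. is_kkt_mult p A y \<eta> x \<mu>) \<and>
           (\<forall>\<mu>. is_kkt_mult p A y \<eta> x \<mu> \<longrightarrow> \<mu> > 0) \<and>
           lp_norm p x = \<eta>))
     \<and>
     (CARD('n) \<ge> CARD('m) \<and> all_square_submatrices_invertible A \<and> y \<noteq> 0 \<longrightarrow>
        (\<exists>!x. is_opt p A y \<eta> x) \<and>
        (\<forall>x. is_opt p A y \<eta> x \<longrightarrow>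
           card {i. x $ i \<noteq> 0} \<ge> CARD('n) - CARD('m) + 1))"
proof -
  have solvable: "\<exists>z. A *v z = y"
    if "rank A = CARD('m) \<or> CARD('m) \<le> CARD('n) \<and> all_square_submatrices_invertible A"
    using that full_rank_surjective[of A] surj_of_all_square_submatrices_invertible[of A]
    by (metis surjD)
  note outside = lp_pow_gt_of_lt_Inf[OF p eta_pos eta_lt]
  show ?thesis
    using is_opt_ex1[OF p eta_pos solvable outside]
      is_opt_ex1_kkt_mult[OF p eta_pos solvable outside]
      is_kkt_mult_pos[OF p eta_pos solvable outside]
      is_opt_lp_norm_eq[OF p eta_pos solvable outside]
      is_opt_card_support[OF p eta_pos solvable outside]
    by (intro conjI impI allI) auto
qed

end
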